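(* Let $\mathcal H$ be a complex Hilbert space of finite dimension $n$ and let $m$ be an odd integer such that $3\le m\le 2n-1$. Then $T\in\mathcal B(\mathcal H)$ is similar to a strict $m$-isometry if and only if $T=U+Q$ for some $U,Q\in\mathcal B(\mathcal H)$ such that $U$ is diagonalizable, all eigenvalues of $U$ are unimodular and at most $\frac{2n+1-m}{2}$ of them are distinct, $Q$ is nilpotent of order $\frac{m+1}{2}$, and $UQ=QU$.
   Context: $\mathcal B(\mathcal H)$ denotes the (bounded) linear operators on $\mathcal H$. For $T\in\mathcal B(\mathcal H)$ and an integer $m\ge1$, let $\beta_m(T)=\sum_{k=0}^m(-1)^{m-k}\binom mk T^{*k}T^k$. $T$ is an $m$-isometry if $\beta_m(T)=0$; it is a strict $m$-isometry if it is an $m$-isometry but not an $(m-1)$-isometry. Operators $A,B$ on $\mathcal H$ are similar if $A=P^{-1}BP$ for some invertible $P\in\mathcal B(\mathcal H)$. $Q$ is nilpotent of order $d\ge1$ if $Q^d=0$ and $Q^{d-1}\neq0$. Unimodular means of absolute value $1$. *)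

theory Defs
  imports Complex_Main
begin

text \<open>
  A complex Hilbert space of finite dimension. The inner product is linear in its first argument.
  In finite dimension completeness is automatic, and every linear operator is bounded, so
  \<open>\<B>(\<H>)\<close> is the set of all linear maps \<open>\<H> \<rightarrow> \<H>\<close>.
\<close>

locale fd_complex_hilbert_space = vector_space sc
  for sc :: "complex \<Rightarrow> 'a::ab_group_add \<Rightarrow> 'a" +
  fixes ip :: "'a \<Rightarrow> 'a \<Rightarrow> complex"
  assumes ip_add_left: "ip (x + y) z = ip x z + ip y z"
    and ip_scale_left: "ip (sc c x) y = c * ip x y"
    and ip_commute: "ip x y = cnj (ip y x)"
    and ip_pos: "x \<noteq> 0 \<Longrightarrow> 0 < Re (ip x x)"
    and finite_dimension: "\<exists>B. finite B \<and> span B = UNIV"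

definition hilbert_ops :: "(complex \<Rightarrow> 'a::ab_group_add \<Rightarrow> 'a) \<Rightarrow> ('a \<Rightarrow> 'a) set" where
  "hilbert_ops sc = {T. Vector_Spaces.linear sc sc T}"

definition hilbert_adjoint :: "('a \<Rightarrow> 'a \<Rightarrow> complex) \<Rightarrow> ('a \<Rightarrow> 'a) \<Rightarrow> 'a \<Rightarrow> 'a" where
  "hilbert_adjoint ip T = (THE S. \<forall>x y. ip (T x) y = ip x (S y))"

definition isometry_defect ::
  "(complex \<Rightarrow> 'a::ab_group_add \<Rightarrow> 'a) \<Rightarrow> ('a \<Rightarrow> 'a \<Rightarrow> complex) \<Rightarrow> nat \<Rightarrow> ('a \<Rightarrow> 'a) \<Rightarrow> 'a \<Rightarrow> 'a" where
  "isometry_defect sc ip m T =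
     (\<lambda>x. \<Sum>k\<le>m. sc ((-1) ^ (m - k) * of_nat (m choose k))
                     ((hilbert_adjoint ip T ^^ k) ((T ^^ k) x)))"

definition m_isometry ::
  "(complex \<Rightarrow> 'a::ab_group_add \<Rightarrow> 'a) \<Rightarrow> ('a \<Rightarrow> 'a \<Rightarrow> complex) \<Rightarrow> nat \<Rightarrow> ('a \<Rightarrow> 'a) \<Rightarrow> bool" where
  "m_isometry sc ip m T \<longleftrightarrow>
     1 \<le> m \<and> T \<in> hilbert_ops sc \<and> isometry_defect sc ip m T = (\<lambda>x. 0)"

definition strict_m_isometry ::
  "(complex \<Rightarrow> 'a::ab_group_add \<Rightarrow> 'a) \<Rightarrow> ('a \<Rightarrow> 'a \<Rightarrow> complex) \<Rightarrow> nat \<Rightarrow> ('a \<Rightarrow> 'a) \<Rightarrow> bool" where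
  "strict_m_isometry sc ip m T \<longleftrightarrow> m_isometry sc ip m T \<and> \<not> m_isometry sc ip (m - 1) T"

text \<open>In the next definition \<open>R\<close> is the inverse of \<open>P\<close>.\<close>

definition similar_ops ::
  "(complex \<Rightarrow> 'a::ab_group_add \<Rightarrow> 'a) \<Rightarrow> ('a \<Rightarrow> 'a) \<Rightarrow> ('a \<Rightarrow> 'a) \<Rightarrow> bool" where
  "similar_ops sc A B \<longleftrightarrow>
     (\<exists>P\<in>hilbert_ops sc. \<exists>R\<in>hilbert_ops sc. R \<circ> P = id \<and> P \<circ> R = id \<and> A = R \<circ> B \<circ> P)"

definition op_eigenvalues ::
  "(complex \<Rightarrow> 'a::ab_group_add \<Rightarrow> 'a) \<Rightarrow> ('a \<Rightarrow> 'a) \<Rightarrow> complex set" where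
  "op_eigenvalues sc U = {c. \<exists>v. v \<noteq> 0 \<and> U v = sc c v}"

definition diagonalizable_op ::
  "(complex \<Rightarrow> 'a::ab_group_add \<Rightarrow> 'a) \<Rightarrow> ('a \<Rightarrow> 'a) \<Rightarrow> bool" where
  "diagonalizable_op sc U \<longleftrightarrow>
     (\<exists>B. \<not> module.dependent sc B \<and> module.span sc B = UNIV \<and> (\<forall>b\<in>B. \<exists>c. U b = sc c b))"

definition nilpotent_of_order :: "nat \<Rightarrow> ('a::zero \<Rightarrow> 'a) \<Rightarrow> bool" where
  "nilpotent_of_order d Q \<longleftrightarrow> 1 \<le> d \<and> Q ^^ d = (\<lambda>x. 0) \<and> Q ^^ (d - 1) \<noteq> (\<lambda>x. 0)"

end

theory Submission
  imports Defs "HOL-Computational_Algebra.Computational_Algebra"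
    "HOL-Computational_Algebra.Field_as_Ring"
begin

text \<open>
  Let \<open>D\<close> map a form \<open>f\<close> to \<open>f (T x) (T y) - f x y\<close>; then \<open>T\<close> is an \<open>m\<close>-isometry iff \<open>D^m ip = 0\<close>,
  and \<open>T\<close> is similar to a strict \<open>m\<close>-isometry iff \<open>T\<close> is one for the inner product
  \<open>ip (P x) (P y)\<close> with some invertible \<open>P\<close>.
  On generalized eigenspaces for \<open>c\<close> and \<open>d\<close>, the operator \<open>D\<close> is \<open>c * cnj d - 1\<close> up to a nilpotent
  part, so \<open>D^m ip = 0\<close> makes these spaces orthogonal unless \<open>c * cnj d = 1\<close>. Hence all eigenvalues
  are unimodular and the diagonalizable part \<open>U\<close> of \<open>T\<close> is unitary.
  Conversely, a diagonalizable \<open>U\<close> with unimodular eigenvalues becomes unitary once an eigenbasis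
  is declared orthonormal. If \<open>T = U + Q\<close> with \<open>U\<close> unitary, commuting with \<open>Q\<close> nilpotent of order \<open>d\<close>,
  then every application of \<open>D\<close> to \<open>ip\<close> produces another factor \<open>Q\<close> on one of the two sides, so
  \<open>D^(2d-1) ip = 0\<close>, while in \<open>D^(2d-2) ip\<close> only \<open>ip (Q^(d-1) x) (Q^(d-1) y)\<close> (up to powers of \<open>U\<close>)
  survives, with coefficient \<open>2d-2\<close> choose \<open>d-1\<close>; hence \<open>m = 2d - 1\<close>.
  The bound on the number of eigenvalues holds because a Jordan chain of length \<open>d\<close> inside one
  eigenspace of \<open>U\<close>, together with one eigenvector from each other eigenspace, is independent.
\<close>

section \<open>The difference operator on forms\<close>

definition form_diff :: "('a \<Rightarrow> 'a) \<Rightarrow> ('a \<Rightarrow> 'a \<Rightarrow> complex) \<Rightarrow> 'a \<Rightarrow> 'a \<Rightarrow> complex" where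
  "form_diff T f = (\<lambda>x y. f (T x) (T y) - f x y)"

lemma form_diff_pow_Suc:
  "(form_diff T ^^ Suc k) f x y = (form_diff T ^^ k) f (T x) (T y) - (form_diff T ^^ k) f x y"
  by (simp add: form_diff_def)

lemma form_diff_pow_Suc': "(form_diff T ^^ Suc k) f = (form_diff T ^^ k) (form_diff T f)"
  by (simp add: funpow_swap1)

lemma form_diff_pow_zero [simp]: "(form_diff T ^^ k) (\<lambda>x y. 0) = (\<lambda>x y. 0)"
  by (induction k) (auto simp: form_diff_def)

lemma form_diff_pow_add:
  "(form_diff T ^^ k) (\<lambda>x y. f x y + g x y) = (\<lambda>x y. (form_diff T ^^ k) f x y + (form_diff T ^^ k) g x y)"
  by (induction k) (auto simp: form_diff_def fun_eq_iff)

lemma form_diff_pow_mono: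
  assumes "(form_diff T ^^ k) f = (\<lambda>x y. 0)" "k \<le> l"
  shows "(form_diff T ^^ l) f = (\<lambda>x y. 0)"
proof -
  have "(form_diff T ^^ l) f = (form_diff T ^^ (l - k)) ((form_diff T ^^ k) f)"
    using assms(2) by (metis funpow_add le_add_diff_inverse2 o_apply)
  then show ?thesis using assms(1) by simp
qed

text \<open>Differences commute with pulling a form back along an intertwiner \<open>P\<close>. This
  trades an operator similar to \<open>T\<close> for \<open>T\<close> itself with a changed inner
  product.\<close>

lemma form_diff_pow_conj:
  assumes "\<And>x. P (T x) = S (P x)"
  shows "(form_diff T ^^ k) (\<lambda>x y. f (P x) (P y)) x y = (form_diff S ^^ k) f (P x) (P y)"
  by (induction k arbitrary: x y) (simp_all add: form_diff_def assms)

text \<open>The predicates \<open>A\<close> and \<open>B\<close> stand for sets invariant under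
  \<open>T\<close>. There \<open>f\<close> is an eigenvector of \<open>form_diff T\<close> for the
  eigenvalue \<open>w - 1\<close>, so iteration gives powers.\<close>

lemma form_diff_pow_eigen:
  assumes "\<And>x y. A x \<Longrightarrow> B y \<Longrightarrow> f (T x) (T y) = w * f x y"
    and "\<And>x. A x \<Longrightarrow> A (T x)" "\<And>y. B y \<Longrightarrow> B (T y)"
  shows "A x \<Longrightarrow> B y \<Longrightarrow> (form_diff T ^^ k) f x y = (w - 1) ^ k * f x y"
proof (induction k arbitrary: x y)
  case (Suc k)
  show ?case
    by (simp only: form_diff_pow_Suc Suc.IH[OF assms(2)[OF Suc.prems(1)] assms(3)[OF Suc.prems(2)]]
        Suc.IH[OF Suc.prems] assms(1)[OF Suc.prems]) (simp add: algebra_simps)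
qed simp

text \<open>By Pascal's rule, the difference of two consecutive \<open>m\<close>-th differences of
  the sequence \<open>g\<close> is the next higher difference.\<close>

lemma alternating_binomial_sum_Suc:
  fixes g :: "nat \<Rightarrow> 'b::comm_ring_1"
  shows "(\<Sum>k\<le>Suc m. (-1) ^ (Suc m - k) * of_nat (Suc m choose k) * g k)
    = (\<Sum>k\<le>m. (-1) ^ (m - k) * of_nat (m choose k) * g (Suc k))
      - (\<Sum>k\<le>m. (-1) ^ (m - k) * of_nat (m choose k) * g k)"
proof -
  have a: "(\<Sum>k\<le>Suc m. (-1) ^ (Suc m - k) * of_nat (Suc m choose k) * g k)
     = (-1) ^ Suc m * g 0 + (\<Sum>k\<le>m. (-1) ^ (m - k) * of_nat (Suc m choose Suc k) * g (Suc k))"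
    by (subst sum.atMost_Suc_shift) simp
  have b: "(\<Sum>k\<le>m. (-1) ^ (m - k) * of_nat (m choose Suc k) * g (Suc k)) + (-1) ^ Suc m * g 0
     = - (\<Sum>k\<le>m. (-1) ^ (m - k) * of_nat (m choose k) * g k)"
  proof -
    have "- (\<Sum>k\<le>m. (-1) ^ (m - k) * of_nat (m choose k) * g k) =
      (\<Sum>k\<le>m. (-1) ^ (Suc m - k) * of_nat (m choose k) * g k)"
      by (auto simp: sum_negf[symmetric] Suc_diff_le intro!: sum.cong)
    also have "\<dots> = (\<Sum>k\<le>Suc m. (-1) ^ (Suc m - k) * of_nat (m choose k) * g k)"
      by (simp add: binomial_eq_0)
    also have "\<dots> = (-1) ^ Suc m * g 0 + (\<Sum>k\<le>m. (-1) ^ (m - k) * of_nat (m choose Suc k) * g (Suc k))"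
      by (subst sum.atMost_Suc_shift) simp
    finally show ?thesis by simp
  qed
  show ?thesis
    unfolding a using b by (simp add: algebra_simps sum.distrib add_eq_0_iff)
qed

lemma form_diff_pow_eq_sum:
  "(form_diff T ^^ m) f x y
     = (\<Sum>k\<le>m. (-1) ^ (m - k) * of_nat (m choose k) * f ((T ^^ k) x) ((T ^^ k) y))"
proof (induction m arbitrary: x y)
  case (Suc m)
  show ?case
    unfolding alternating_binomial_sum_Suc form_diff_pow_Suc Suc.IH
    by (simp add: funpow_swap1)
qed simp

section \<open>A Bezout identity for powers of linear polynomials\<close>

lemma coprime_linear_factors:
  fixes c d :: complex
  assumes "c \<noteq> d"
  shows "coprime [:-c, 1:] [:-d, 1:]"
proof (rule coprimeI)
  fix l assume "l dvd [:-c, 1:]" "l dvd [:-d, 1:]"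
  then have "l dvd [:-c, 1:] - [:-d, 1:]" by (rule dvd_diff)
  then have "l dvd [:d - c:]" by simp
  moreover have "[:d - c:] dvd 1" using assms by (simp add: is_unit_const_poly_iff dvd_field_iff)
  ultimately show "is_unit l" by (rule dvd_trans)
qed

text \<open>This is the source of the projections onto generalized eigenspaces. In the induction the
  new factor \<open>?L\<close> is coprime to the product \<open>?Q\<close> of the old ones, so
  \<open>u * ?L + v * ?Q = 1\<close>; multiplying the summand \<open>u * ?L\<close> by the old
  identity makes every term a multiple of the required product.\<close>

lemma linear_powers_partition_of_unity:
  fixes C :: "complex set" and e :: "complex \<Rightarrow> nat"
  assumes "finite C" "C \<noteq> {}"
  shows "\<exists>a. (\<Sum>c\<in>C. a c * (\<Prod>d\<in>C - {c}. [:-d, 1:] ^ e d)) = (1 :: complex poly)"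
  using assms
proof (induction C rule: finite_ne_induct)
  case (singleton x)
  show ?case by (rule exI[of _ "\<lambda>_. 1"]) simp
next
  case (insert x C)
  then obtain a where a: "(\<Sum>c\<in>C. a c * (\<Prod>d\<in>C - {c}. [:-d, 1:] ^ e d)) = 1" by blast
  let ?L = "[:-x, 1:] ^ e x" and ?Q = "\<Prod>d\<in>C. [:-d, 1:] ^ e d"
  have "coprime ?L ?Q"
    using insert by (intro prod_coprime_right coprime_power_right_iff[THEN iffD2] coprime_power_left_iff[THEN iffD2]
      disjI1 disjI2 coprime_linear_factors) (auto intro!: coprime_linear_factors)
  then obtain u v where uv: "u * ?L + v * ?Q = 1"
    using that[of "fst (bezout_coefficients ?L ?Q)" "snd (bezout_coefficients ?L ?Q)"]
    by (simp only: bezout_coefficients_fst_snd coprime_imp_gcd_eq_1)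
  define b where "b = (\<lambda>c. if c = x then v else u * a c)"
  have "(\<Sum>c\<in>insert x C. b c * (\<Prod>d\<in>insert x C - {c}. [:-d, 1:] ^ e d))
    = v * ?Q + (\<Sum>c\<in>C. b c * (\<Prod>d\<in>insert x C - {c}. [:-d, 1:] ^ e d))"
    using insert by (simp add: b_def)
  also have "(\<Sum>c\<in>C. b c * (\<Prod>d\<in>insert x C - {c}. [:-d, 1:] ^ e d))
    = (\<Sum>c\<in>C. u * ?L * (a c * (\<Prod>d\<in>C - {c}. [:-d, 1:] ^ e d)))"
  proof (rule sum.cong)
    fix c assume c: "c \<in> C"
    then have "insert x C - {c} = insert x (C - {c})" using insert by auto
    then show "b c * (\<Prod>d\<in>insert x C - {c}. [:-d, 1:] ^ e d)
        = u * ?L * (a c * (\<Prod>d\<in>C - {c}. [:-d, 1:] ^ e d))"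
      using insert c by (auto simp: b_def)
  qed simp
  also have "\<dots> = u * ?L" by (simp add: sum_distrib_left[symmetric] a)
  finally show ?case using uv by (intro exI[of _ b]) (simp only: add.commute)
qed

section \<open>Polynomials in a linear operator\<close>

text \<open>
  A copy of \<^locale>\<open>vector_space\<close>: names declared in that locale itself would also be
  exported by its global interpretation for real vector spaces.
\<close>

locale operator_space = vector_space
begin

abbreviation "lin \<equiv> Vector_Spaces.linear scale scale"

text \<open>Horner's scheme for the operator \<open>p(T)\<close>, evaluated pointwise.\<close>

definition poly_op :: "('b \<Rightarrow> 'b) \<Rightarrow> 'a poly \<Rightarrow> 'b \<Rightarrow> 'b" where
  "poly_op T p = fold_coeffs (\<lambda>a f x. scale a x + T (f x)) p (\<lambda>_. 0)"

lemma linI: "(\<And>x y. T (x + y) = T x + T y) \<Longrightarrow> (\<And>c x. T (scale c x) = scale c (T x)) \<Longrightarrow> lin T"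
  by (simp add: Vector_Spaces.linear_iff vector_space_axioms)

lemma lin_simps:
  assumes "lin T"
  shows "T (x + y) = T x + T y" "T (scale c x) = scale c (T x)" "T 0 = 0" "T (x - y) = T x - T y"
    "T (sum f A) = (\<Sum>a\<in>A. T (f a))" "T (- x) = - T x"
proof -
  interpret T: Vector_Spaces.linear scale scale T by fact
  show "T (x + y) = T x + T y" "T (scale c x) = scale c (T x)" "T 0 = 0" "T (x - y) = T x - T y"
    "T (sum f A) = (\<Sum>a\<in>A. T (f a))" "T (- x) = - T x"
    by (auto simp: T.add T.scale T.diff T.sum T.neg)
qed

lemma lin_pow: "lin T \<Longrightarrow> lin (T ^^ k)"
  by (induction k) (auto intro!: linI simp: lin_simps)

lemma lin_eq_on_span:
  assumes "lin S" "lin T" "x \<in> span B" "\<And>b. b \<in> B \<Longrightarrow> S b = T b"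
  shows "S x = T x"
  using assms(3)
  by (induction rule: span_induct_alt) (auto simp: lin_simps[OF assms(1)] lin_simps[OF assms(2)] assms(4))

context
  fixes T assumes T: "lin T"
begin

lemmas T_simps = lin_simps[OF T]

lemma poly_op_0 [simp]: "poly_op T 0 x = 0"
  by (simp add: poly_op_def)

lemma poly_op_pCons: "poly_op T (pCons a p) x = scale a x + T (poly_op T p x)"
proof (cases "p = 0 \<and> a = 0")
  case True
  then show ?thesis by (simp add: poly_op_def T_simps)
next
  case False
  then show ?thesis by (auto simp: poly_op_def T_simps)
qed

lemma poly_op_add: "poly_op T (p + q) x = poly_op T p x + poly_op T q x"
  by (induction p q rule: poly_induct2) (simp_all add: poly_op_pCons T_simps algebra_simps)

lemma poly_op_smult: "poly_op T (smult a p) x = scale a (poly_op T p x)"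
proof (induction p)
  case (pCons b p)
  show ?case
    by (simp only: smult_pCons poly_op_pCons pCons.IH T_simps scale_right_distrib scale_scale)
qed simp

lemma poly_op_1 [simp]: "poly_op T 1 x = x"
  by (simp add: one_pCons poly_op_pCons T_simps)

lemma lin_poly_op: "lin (poly_op T p)"
proof (rule linI)
  show "poly_op T p (x + y) = poly_op T p x + poly_op T p y" for x y
    by (induction p) (simp_all add: poly_op_pCons T_simps scale_right_distrib)
  show "poly_op T p (scale c x) = scale c (poly_op T p x)" for c x
  proof (induction p)
    case (pCons b p)
    show ?case
      by (simp only: poly_op_pCons pCons.IH T_simps scale_right_distrib scale_scale mult.commute)
  qed simp
qed

lemma poly_op_T: "poly_op T p (T x) = T (poly_op T p x)"
  by (induction p) (simp_all add: poly_op_pCons T_simps)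

lemma poly_op_mult: "poly_op T (p * q) x = poly_op T p (poly_op T q x)"
  by (induction p) (simp_all add: poly_op_pCons poly_op_add poly_op_smult)

lemma poly_op_sum: "poly_op T (\<Sum>i\<in>A. p i) x = (\<Sum>i\<in>A. poly_op T (p i) x)"
  by (induction A rule: infinite_finite_induct) (simp_all add: poly_op_add)

lemma poly_op_monom: "poly_op T (monom a i) x = scale a ((T ^^ i) x)"
  by (induction i) (simp_all add: monom_0 monom_Suc poly_op_pCons T_simps)

lemma poly_op_linear_power: "poly_op T ([:-c, 1:] ^ k) x = ((\<lambda>x. T x - scale c x) ^^ k) x"
  by (induction k arbitrary: x) (simp_all add: poly_op_pCons poly_op_mult T_simps del: mult_pCons_left)

text \<open>The iterates of \<open>x\<close> with exponents up to \<open>card B\<close> are one more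
  than the dimension allows, so a linear relation holds among them; its coefficients form
  \<open>p\<close>.\<close>

lemma ex_poly_op_annihilates_vector:
  assumes B: "finite B" "span B = UNIV"
  shows "\<exists>p. p \<noteq> 0 \<and> poly_op T p x = 0"
\<comment> \<open>Dependence is a property of the set of iterates, which does not see repetitions. A
  repeated iterate is therefore treated separately and gives a difference of two monomials.\<close>
proof (cases "inj_on (\<lambda>i. (T ^^ i) x) {..card B}")
  case False
  then obtain i j where ij: "i \<noteq> j" "(T ^^ i) x = (T ^^ j) x" by (auto simp: inj_on_def)
  have "poly_op T (monom 1 i + monom (-1) j) x = 0"
    by (simp add: poly_op_add poly_op_monom ij)
  moreover have "monom 1 i + monom (-1) j \<noteq> (0 :: 'a poly)"
    using ij by (auto simp: poly_eq_iff intro!: exI[of _ i])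
  ultimately show ?thesis by blast
next
  case inj: True
  let ?w = "\<lambda>i. (T ^^ i) x"
  have "dependent (?w ` {..card B})"
  proof (rule ccontr)
    assume "independent (?w ` {..card B})"
    then have "card (?w ` {..card B}) \<le> card B"
      using independent_span_bound[OF B(1)] B(2) by blast
    then show False by (simp add: card_image[OF inj])
  qed
  then obtain u i where u: "(\<Sum>v\<in>?w ` {..card B}. scale (u v) v) = 0" and i: "i \<le> card B" "u (?w i) \<noteq> 0"
    by (auto simp: dependent_finite)
  have "poly_op T (\<Sum>i\<le>card B. monom (u (?w i)) i) x = 0"
    using u by (simp add: poly_op_sum poly_op_monom sum.reindex[OF inj] o_def)
  moreover have "coeff (\<Sum>i\<le>card B. monom (u (?w i)) i) i = u (?w i)"
    using i by (simp add: coeff_sum)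
  then have "(\<Sum>i\<le>card B. monom (u (?w i)) i) \<noteq> 0" using i by fastforce
  ultimately show ?thesis by blast
qed

text \<open>Polynomials in \<open>T\<close> commute, so the product of annihilators of the vectors
  of a spanning set kills each of these vectors.\<close>

lemma ex_poly_op_annihilates:
  assumes B: "finite B" "span B = UNIV"
  shows "\<exists>p. p \<noteq> 0 \<and> (\<forall>x. poly_op T p x = 0)"
proof -
  obtain p where p: "\<And>x. p x \<noteq> 0" "\<And>x. poly_op T (p x) x = 0"
    using ex_poly_op_annihilates_vector[OF B] by metis
  have "poly_op T (\<Prod>b\<in>B. p b) x = 0" for x
  proof -
    have "poly_op T (\<Prod>b\<in>B. p b) x = (\<lambda>x. 0) x"
    proof (rule lin_eq_on_span[OF lin_poly_op])
      show "lin (\<lambda>x. 0)" by (rule linI) auto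
      show "x \<in> span B" using B by simp
      fix b assume "b \<in> B"
      then have "(\<Prod>b\<in>B. p b) = (\<Prod>b\<in>B - {b}. p b) * p b"
        using B by (simp add: prod.remove mult.commute)
      then show "poly_op T (\<Prod>b\<in>B. p b) b = 0"
        by (simp only: poly_op_mult p lin_simps[OF lin_poly_op])
    qed
    then show ?thesis .
  qed
  moreover have "(\<Prod>b\<in>B. p b) \<noteq> 0" using p B by simp
  ultimately show ?thesis by blast
qed

end

end

section \<open>Inner products, orthonormal bases and adjoints\<close>

sublocale fd_complex_hilbert_space \<subseteq> operator_space sc ..

context fd_complex_hilbert_space
begin

lemma ip_add_right: "ip z (x + y) = ip z x + ip z y"
  by (subst (1 2 3) ip_commute) (simp add: ip_add_left)

lemma ip_scale_right: "ip x (sc c y) = cnj c * ip x y"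
  by (subst (1 2) ip_commute) (simp add: ip_scale_left)

lemma ip_zero_left [simp]: "ip 0 y = 0"
  using ip_scale_left[of 0 0 y] by simp

lemma ip_zero_right [simp]: "ip x 0 = 0"
  using ip_scale_right[of x 0 0] by simp

lemma ip_diff_left: "ip (x - y) z = ip x z - ip y z"
  using ip_add_left[of "x - y" y z] by simp

lemma ip_diff_right: "ip z (x - y) = ip z x - ip z y"
  using ip_add_right[of z "x - y" y] by simp

lemma ip_sum_left: "ip (\<Sum>a\<in>A. f a) y = (\<Sum>a\<in>A. ip (f a) y)"
  by (induction A rule: infinite_finite_induct) (simp_all add: ip_add_left)

lemma ip_sum_right: "ip x (\<Sum>a\<in>A. f a) = (\<Sum>a\<in>A. ip x (f a))"
  by (induction A rule: infinite_finite_induct) (simp_all add: ip_add_right)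

lemmas ip_simps = ip_add_left ip_add_right ip_scale_left ip_scale_right ip_diff_left ip_diff_right

lemma ip_self_eq_0_iff [simp]: "ip x x = 0 \<longleftrightarrow> x = 0"
  using ip_pos[of x] by (cases "x = 0") auto

lemma ip_left_eqI: "(\<And>y. ip x y = ip z y) \<Longrightarrow> x = z"
  using ip_self_eq_0_iff[of "x - z"] by (simp add: ip_diff_left)

lemma ip_right_eqI: "(\<And>y. ip y x = ip y z) \<Longrightarrow> x = z"
  using ip_self_eq_0_iff[of "x - z"] by (simp add: ip_diff_right)

lemma card_independent_le_dim:
  assumes "independent B"
  shows "finite B \<and> card B \<le> dim UNIV"
proof -
  obtain F where F: "finite F" "span F = UNIV" using finite_dimension by blast
  obtain E where E: "E \<subseteq> UNIV" "independent E" "UNIV \<subseteq> span E" "card E = dim UNIV"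
    using basis_exists[of UNIV] by auto
  have "finite E" using independent_span_bound[OF F(1) E(2)] F(2) by auto
  then show ?thesis using independent_span_bound[OF _ assms, of E] E by auto
qed

definition orthonormal :: "'a set \<Rightarrow> bool" where
  "orthonormal E \<longleftrightarrow> (\<forall>e\<in>E. \<forall>f\<in>E. ip e f = (if e = f then 1 else 0))"

lemma orthonormal_independent:
  assumes E: "orthonormal E"
  shows "independent E"
proof -
  have "u e = 0" if F: "finite F" "F \<subseteq> E" "(\<Sum>v\<in>F. sc (u v) v) = 0" "e \<in> F" for u F e
  proof -
    have "0 = ip (\<Sum>v\<in>F. sc (u v) v) e" using F by simp
    also have "\<dots> = (\<Sum>v\<in>F. u v * ip v e)" by (simp add: ip_sum_left ip_scale_left)
    also have "\<dots> = (\<Sum>v\<in>F. if v = e then u v else 0)"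
      using E F by (intro sum.cong) (auto simp: orthonormal_def subset_eq)
    also have "\<dots> = u e" using F by simp
    finally show ?thesis by simp
  qed
  then show ?thesis unfolding dependent_explicit by blast
qed

lemma gram_schmidt:
  assumes "finite B"
  shows "\<exists>E. finite E \<and> orthonormal E \<and> span E = span B"
  using assms
proof (induction B rule: finite_induct)
  case empty
  show ?case by (rule exI[of _ "{}"]) (auto simp: orthonormal_def)
next
  case (insert b B)
  then obtain E where E: "finite E" "orthonormal E" "span E = span B" by blast
  show ?case
  proof (cases "b \<in> span B")
    case True
    then show ?thesis using E by (intro exI[of _ E]) (simp add: span_redundant)
  next
    case False
    \<comment> \<open>\<open>p\<close> is the orthogonal projection of \<open>b\<close> onto
      \<open>span E\<close>. The remainder \<open>w\<close> is orthogonal to \<open>E\<close>, and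
      \<open>r\<close> normalizes it.\<close>
    define p where "p = (\<Sum>e\<in>E. sc (ip b e) e)"
    define w where "w = b - p"
    have p: "p \<in> span E" unfolding p_def by (intro span_sum span_scale span_base)
    then have "w \<noteq> 0" using False E unfolding w_def by auto
    define r where "r = complex_of_real (1 / sqrt (Re (ip w w)))"
    have orth: "ip w f = 0" "ip f w = 0" if "f \<in> E" for f
    proof -
      have "ip p f = (\<Sum>e\<in>E. if e = f then ip b f else 0)"
        unfolding p_def ip_sum_left using E(2) that
        by (intro sum.cong) (auto simp: orthonormal_def ip_scale_left)
      then show "ip w f = 0" using that E by (simp add: w_def ip_diff_left)
      then show "ip f w = 0" by (subst ip_commute) simp
    qed
    have real: "ip w w = complex_of_real (Re (ip w w))"
      using arg_cong[OF ip_commute[of w w], of Im] by (simp add: complex_eq_iff)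
    have pos: "Re (ip w w) > 0" using ip_pos \<open>w \<noteq> 0\<close> by blast
    have "r * cnj r * ip w w = 1"
      unfolding r_def by (subst real) (use pos in \<open>simp add: real_sqrt_mult_self flip: of_real_mult\<close>)
    then have nrm: "ip (sc r w) (sc r w) = 1" by (simp add: ip_scale_left ip_scale_right ac_simps)
    have "r \<noteq> 0" using pos by (simp add: r_def)
    have "sc r w \<notin> E" using orth(1)[of "sc r w"] nrm by (auto simp: ip_scale_left)
    have on: "orthonormal (insert (sc r w) E)"
      using E(2) nrm orth \<open>sc r w \<notin> E\<close> unfolding orthonormal_def
      by (auto simp: ip_scale_left ip_scale_right)
    have "span (insert (sc r w) E) = span (insert b E)"
    proof (rule span_eq[THEN iffD2], intro conjI subsetI)
      fix z assume "z \<in> insert (sc r w) E"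
      moreover have "w \<in> span (insert b E)"
        unfolding w_def using p by (meson insertI1 span_base span_diff span_mono subsetD subset_insertI)
      ultimately show "z \<in> span (insert b E)"
        by (auto intro: span_scale span_base)
    next
      fix z assume z: "z \<in> insert b E"
      have "sc (1 / r) (sc r w) \<in> span (insert (sc r w) E)"
        by (intro span_scale span_base) simp
      then have "w \<in> span (insert (sc r w) E)" using \<open>r \<noteq> 0\<close> by simp
      moreover have "p \<in> span (insert (sc r w) E)"
        using p by (meson span_mono subsetD subset_insertI)
      ultimately have "w + p \<in> span (insert (sc r w) E)" by (rule span_add)
      then have "b \<in> span (insert (sc r w) E)" by (simp add: w_def)
      then show "z \<in> span (insert (sc r w) E)" using z by (auto intro: span_base)
    qed
    also have "\<dots> = span (insert b B)" using E(3) by (simp add: span_insert)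
    finally show ?thesis using on E(1) by (intro exI[of _ "insert (sc r w) E"]) simp
  qed
qed

lemma ex_orthonormal_basis: "\<exists>E. finite E \<and> orthonormal E \<and> independent E \<and> span E = UNIV"
proof -
  obtain B where "finite B" "span B = UNIV" using finite_dimension by blast
  then show ?thesis using gram_schmidt[of B] orthonormal_independent by auto
qed

lemma orthonormal_expand:
  assumes "finite E" "orthonormal E" "span E = UNIV"
  shows "x = (\<Sum>e\<in>E. sc (ip x e) e)"
proof -
  let ?F = "\<lambda>x. \<Sum>e\<in>E. sc (ip x e) e"
  have "lin ?F"
    by (rule linI) (simp_all add: ip_add_left ip_scale_left scale_left_distrib sum.distrib scale_sum_right)
  moreover have "?F b = b" if "b \<in> E" for b
  proof -
    have "?F b = (\<Sum>e\<in>E. if e = b then b else 0)"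
      using assms(2) that by (intro sum.cong) (auto simp: orthonormal_def)
    then show ?thesis using that assms(1) by simp
  qed
  moreover have "lin id" by (rule linI) simp_all
  ultimately have "id x = ?F x"
    using lin_eq_on_span[of id ?F x E] assms(3) by simp
  then show ?thesis by simp
qed

lemma hilbert_adjoint_ip:
  assumes T: "lin T"
  shows "ip (T x) y = ip x (hilbert_adjoint ip T y)"
proof -
  obtain E where E: "finite E" "orthonormal E" "span E = UNIV" using ex_orthonormal_basis by blast
  \<comment> \<open>The coordinates of the adjoint in an orthonormal basis. This witness gives
    existence for the description operator, and nondegeneracy of \<open>ip\<close> gives
    uniqueness.\<close>
  define S where "S y = (\<Sum>e\<in>E. sc (cnj (ip (T e) y)) e)" for y
  have "ip (T x) y = ip x (S y)" for x y
  proof -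
    have "ip (T x) y = ip (T (\<Sum>e\<in>E. sc (ip x e) e)) y"
      using orthonormal_expand[OF E, of x] by simp
    also have "\<dots> = ip x (S y)"
      by (simp add: lin_simps[OF T] ip_sum_left ip_sum_right ip_scale_left ip_scale_right S_def mult.commute)
    finally show ?thesis .
  qed
  then have S: "\<forall>x y. ip (T x) y = ip x (S y)" by blast
  have "\<forall>x y. ip (T x) y = ip x (hilbert_adjoint ip T y)"
    unfolding hilbert_adjoint_def
  proof (rule theI[of _ S])
    show "\<forall>x y. ip (T x) y = ip x (S y)" by fact
    fix S' assume "\<forall>x y. ip (T x) y = ip x (S' y)"
    then show "S' = S" using S by (intro ext ip_right_eqI) simp
  qed
  then show ?thesis by blast
qed

section \<open>Isometry defects as iterated differences of the inner product\<close>

text \<open>Moving each adjoint power to the other side of \<open>ip\<close> turns the defect into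
  the binomial expansion of the iterated difference.\<close>

lemma ip_isometry_defect:
  assumes T: "lin T"
  shows "ip (isometry_defect sc ip m T x) y = (form_diff T ^^ m) ip x y"
proof -
  have adj: "ip (hilbert_adjoint ip T u) v = ip u (T v)" for u v
    using arg_cong[OF hilbert_adjoint_ip[OF T, of v u], of cnj] by (simp flip: ip_commute)
  have "ip ((hilbert_adjoint ip T ^^ k) u) v = ip u ((T ^^ k) v)" for k u v
    by (induction k arbitrary: u v) (simp_all add: adj funpow_swap1)
  then show ?thesis
    unfolding isometry_defect_def form_diff_pow_eq_sum
    by (simp add: ip_sum_left ip_scale_left)
qed

lemma m_isometry_iff:
  "m_isometry sc ip m T \<longleftrightarrow> 1 \<le> m \<and> lin T \<and> (form_diff T ^^ m) ip = (\<lambda>x y. 0)"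
proof -
  have "isometry_defect sc ip m T = (\<lambda>x. 0) \<longleftrightarrow> (form_diff T ^^ m) ip = (\<lambda>x y. 0)" if "lin T"
  proof
    assume "isometry_defect sc ip m T = (\<lambda>x. 0)"
    then show "(form_diff T ^^ m) ip = (\<lambda>x y. 0)"
      by (intro ext) (simp flip: ip_isometry_defect[OF that])
  next
    assume "(form_diff T ^^ m) ip = (\<lambda>x y. 0)"
    then show "isometry_defect sc ip m T = (\<lambda>x. 0)"
      by (intro ext ip_left_eqI) (simp add: ip_isometry_defect[OF that])
  qed
  then show ?thesis by (auto simp: m_isometry_def hilbert_ops_def)
qed

text \<open>The bound on \<open>m\<close> keeps \<open>m - 1\<close> positive:
  \<open>m_isometry\<close> is false at index \<open>0\<close> by definition, whatever the form says
  there.\<close>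

lemma strict_m_isometry_iff:
  assumes "2 \<le> m"
  shows "strict_m_isometry sc ip m T \<longleftrightarrow>
    lin T \<and> (form_diff T ^^ m) ip = (\<lambda>x y. 0) \<and> (form_diff T ^^ (m - 1)) ip \<noteq> (\<lambda>x y. 0)"
  using assms by (auto simp: strict_m_isometry_def m_isometry_iff)

text \<open>A similarity becomes a change of inner product, and everything proved here can then be
  instantiated for the new one.\<close>

lemma pullback_space:
  assumes P: "lin P" "inj P"
  shows "fd_complex_hilbert_space sc (\<lambda>x y. ip (P x) (P y))"
proof unfold_locales
  show "ip (P x) (P y) = cnj (ip (P y) (P x))" for x y
    by (rule ip_commute)
  fix x :: 'a assume "x \<noteq> 0"
  then have "P x \<noteq> 0" using injD[OF P(2), of x 0] by (auto simp: lin_simps[OF P(1)])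
  then show "0 < Re (ip (P x) (P x))" by (rule ip_pos)
qed (use finite_dimension in \<open>simp_all add: lin_simps[OF P(1)] ip_simps\<close>)

section \<open>Generalized eigenspaces and the unitary part\<close>

text \<open>Induction on \<open>k + l\<close>: applying \<open>T - c\<close> on the left or
  \<open>T - d\<close> on the right lowers the sum, so these terms vanish and \<open>T\<close>
  scales \<open>ip\<close> by exactly \<open>c * cnj d\<close> on the two kernels. The iterated
  difference is then \<open>(c * cnj d - 1) ^ m * ip x y\<close>, with a nonzero factor.\<close>

lemma generalized_eigenvectors_orthogonal:
  assumes T: "lin T" and m: "(form_diff T ^^ m) ip = (\<lambda>x y. 0)" and cd: "c * cnj d \<noteq> 1"
    and x: "((\<lambda>x. T x - sc c x) ^^ k) x = 0" and y: "((\<lambda>x. T x - sc d x) ^^ l) y = 0"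
  shows "ip x y = 0"
  using x y
proof (induction "k + l" arbitrary: k l x y rule: less_induct)
  case less
  show ?case
  proof (cases "k = 0 \<or> l = 0")
    case True
    then show ?thesis using less.prems by auto
  next
    case False
    then obtain k' l' where kl: "k = Suc k'" "l = Suc l'" by (meson not0_implies_Suc)
    define K where "K c = (\<lambda>x. T x - sc c x)" for c
    have KT: "(K c ^^ k) (T x) = T ((K c ^^ k) x)" for c k x
      by (induction k arbitrary: x) (simp_all add: K_def lin_simps[OF T])
    have prems: "(K c ^^ k) x = 0" "(K d ^^ l) y = 0" using less.prems by (simp_all add: K_def)
    have IH: "ip x y = 0" if "i + j < k + l" "(K c ^^ i) x = 0" "(K d ^^ j) y = 0" for i j x y
      using less.hyps[of i j x y] that unfolding K_def by blast
    have step: "ip (T x) (T y) = c * cnj d * ip x y"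
      if "(K c ^^ k) x = 0" "(K d ^^ l) y = 0" for x y
    proof -
      have "(K c ^^ k') (K c x) = 0" "(K d ^^ l') (K d y) = 0"
        using that by (simp_all add: kl funpow_swap1)
      then have "ip (K c x) y = 0" "ip x (K d y) = 0" "ip (K c x) (K d y) = 0"
        using that IH[of k' l] IH[of k l'] IH[of k' l'] by (simp_all add: kl)
      moreover have "T x = sc c x + K c x" "T y = sc d y + K d y" by (simp_all add: K_def)
      ultimately show ?thesis by (simp add: ip_simps)
    qed
    have "(form_diff T ^^ m) ip x y = (c * cnj d - 1) ^ m * ip x y"
    proof (rule form_diff_pow_eigen[where A = "\<lambda>u. (K c ^^ k) u = 0" and B = "\<lambda>v. (K d ^^ l) v = 0"])
      fix u v assume "(K c ^^ k) u = 0" "(K d ^^ l) v = 0"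
      then show "ip (T u) (T v) = c * cnj d * ip u v" by (rule step)
    qed (simp_all add: KT lin_simps[OF T] prems)
    then show ?thesis using m cd by simp
  qed
qed

lemma generalized_eigenspace_projections:
  assumes T: "lin T" and nz: "\<exists>x :: 'a. x \<noteq> 0"
  obtains C e N where "finite C"
    "\<And>c. lin (e c)"
    "\<And>c x. e c (T x) = T (e c x)"
    "\<And>x. (\<Sum>c\<in>C. e c x) = x"
    "\<And>c x. c \<in> C \<Longrightarrow> ((\<lambda>x. T x - sc c x) ^^ N) (e c x) = 0"
    "\<And>c d x. c \<in> C \<Longrightarrow> d \<in> C \<Longrightarrow> c \<noteq> d \<Longrightarrow> e d (e c x) = 0"
proof -
  obtain p where p: "p \<noteq> 0" "\<And>x. poly_op T p x = 0"
    using finite_dimension ex_poly_op_annihilates[OF T] by blast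
  \<comment> \<open>\<open>p\<close> need not be minimal, so \<open>C\<close> may contain numbers
    that are not eigenvalues; their projections are zero.\<close>
  define C where "C = {z. poly p z = 0}"
  let ?r = "\<lambda>z. [:-z, 1:] ^ order z p"
  define q where "q c = (\<Prod>d\<in>C - {c}. ?r d)" for c
  have C: "finite C" unfolding C_def using p(1) by (rule poly_roots_finite)
  have dec: "smult (lead_coeff p) (\<Prod>z\<in>C. ?r z) = p"
    unfolding C_def by (rule complex_poly_decompose)
  have prod0: "poly_op T (\<Prod>z\<in>C. ?r z) x = 0" for x
    using p poly_op_smult[OF T, of "lead_coeff p" "\<Prod>z\<in>C. ?r z" x] by (simp add: dec)
  \<comment> \<open>An empty product would be \<open>1\<close>, whose operator is the identity; that
    vanishes only on the zero space.\<close>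
  have "C \<noteq> {}"
    using prod0 nz by (auto simp: poly_op_1[OF T])
  then obtain a where a: "(\<Sum>c\<in>C. a c * q c) = 1"
    using linear_powers_partition_of_unity[OF C, of "\<lambda>c. order c p"] unfolding q_def by blast
  define e where "e c = poly_op T (a c * q c)" for c
  have kill: "poly_op T (?r c) (e c x) = 0" if "c \<in> C" for c x
  proof -
    have "?r c * (a c * q c) = a c * (\<Prod>z\<in>C. ?r z)"
      using C that by (simp add: q_def prod.remove)
    then have "poly_op T (?r c) (e c x) = poly_op T (a c * (\<Prod>z\<in>C. ?r z)) x"
      unfolding e_def by (simp only: poly_op_mult[OF T, symmetric])
    then show ?thesis by (simp only: poly_op_mult[OF T] prod0 lin_simps[OF lin_poly_op[OF T]])
  qed
  have zero: "lin S \<Longrightarrow> S 0 = 0" for S :: "'a \<Rightarrow> 'a" by (rule lin_simps)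
  \<comment> \<open>One exponent that bounds all multiplicities at once.\<close>
  define N where "N = (\<Sum>c\<in>C. order c p)"
  show thesis
  proof (rule that[OF C])
    show "lin (e c)" for c unfolding e_def by (rule lin_poly_op[OF T])
    show "e c (T x) = T (e c x)" for c x unfolding e_def by (rule poly_op_T[OF T])
    show "(\<Sum>c\<in>C. e c x) = x" for x
      using poly_op_sum[OF T, of "\<lambda>c. a c * q c" C x] by (simp add: e_def a poly_op_1[OF T])
    show "((\<lambda>x. T x - sc c x) ^^ N) (e c x) = 0" if "c \<in> C" for c x
    proof -
      have "order c p \<le> N" unfolding N_def using C that by (intro member_le_sum) auto
      then have "[:-c, 1:] ^ N = [:-c, 1:] ^ (N - order c p) * ?r c"
        by (simp flip: power_add)
      then have "poly_op T ([:-c, 1:] ^ N) (e c x) = 0"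
        by (simp only: poly_op_mult[OF T] kill[OF that] zero[OF lin_poly_op[OF T]])
      then show ?thesis by (simp only: poly_op_linear_power[OF T])
    qed
    show "e d (e c x) = 0" if "c \<in> C" "d \<in> C" "c \<noteq> d" for c d x
    proof -
      have "q d = (\<Prod>z\<in>C - {d} - {c}. ?r z) * ?r c"
        unfolding q_def using C that by (subst prod.remove[of _ c]) auto
      then show ?thesis
        unfolding e_def[of d]
        by (simp only: poly_op_mult[OF T] kill[OF that(1)] zero[OF lin_poly_op[OF T]])
    qed
  qed
qed

lemma unitary_plus_nilpotent_decomposition:
  assumes T: "lin T" and nz: "\<exists>x :: 'a. x \<noteq> 0" and m: "(form_diff T ^^ m) ip = (\<lambda>x y. 0)"
  obtains U Q N where "lin U" "lin Q" "T = (\<lambda>x. U x + Q x)" "U \<circ> Q = Q \<circ> U"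
    "Q ^^ N = (\<lambda>x. 0)" "\<And>x y. ip (U x) (U y) = ip x y" "diagonalizable_op sc U"
proof -
  obtain C e N where C: "finite C"
    and lin_e: "\<And>c. lin (e c)"
    and e_T: "\<And>c x. e c (T x) = T (e c x)"
    and e_sum: "\<And>x. (\<Sum>c\<in>C. e c x) = x"
    and e_N: "\<And>c x. c \<in> C \<Longrightarrow> ((\<lambda>x. T x - sc c x) ^^ N) (e c x) = 0"
    and e_e: "\<And>c d x. c \<in> C \<Longrightarrow> d \<in> C \<Longrightarrow> c \<noteq> d \<Longrightarrow> e d (e c x) = 0"
    using generalized_eigenspace_projections[OF T nz] by blast
  define U where "U x = (\<Sum>c\<in>C. sc c (e c x))" for x
  define Q where "Q x = T x - U x" for x
  have lin_U: "lin U"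
    by (rule linI) (simp_all add: U_def lin_simps[OF lin_e] scale_right_distrib sum.distrib
        scale_sum_right mult.commute)
  have lin_Q: "lin Q"
    by (rule linI) (simp_all add: Q_def lin_simps[OF lin_U] lin_simps[OF T] scale_right_diff_distrib)
  have TU: "T (U x) = U (T x)" for x
    by (simp add: U_def lin_simps[OF T] e_T)
  have e_idem: "e c (e c x) = e c x" if "c \<in> C" for c x
  proof -
    have "(\<Sum>d\<in>C. e d (e c x)) = e c (e c x)"
      using C that e_e by (auto simp: sum.remove intro!: sum.neutral)
    then show ?thesis by (simp add: e_sum)
  qed
  have U_e: "U (e c x) = sc c (e c x)" if "c \<in> C" for c x
  proof -
    have "(\<Sum>d\<in>C - {c}. sc d (e d (e c x))) = 0"
      by (intro sum.neutral) (auto simp: e_e that)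
    then show ?thesis unfolding U_def using C that by (simp add: sum.remove e_idem)
  qed
  have ortho: "ip (e c x) (e d y) = 0" if "c \<in> C" "d \<in> C" "c * cnj d \<noteq> 1" for c d x y
    by (rule generalized_eigenvectors_orthogonal[OF T m that(3) e_N e_N]) (use that in auto)
  have unimod: "c * cnj c = 1 \<or> e c x = 0" if "c \<in> C" for c x
    using ortho[OF that that, of x x] by auto
  \<comment> \<open>Either \<open>c * cnj d = 1\<close>, or the inner product is zero by
    orthogonality. Termwise comparison then makes \<open>U\<close> unitary.\<close>
  have terms: "c * cnj d * ip (e c x) (e d y) = ip (e c x) (e d y)"
    if "c \<in> C" "d \<in> C" for c d x y
    using ortho[OF that, of x y] by auto
  have unitary: "ip (U x) (U y) = ip x y" for x y
  proof -
    have "ip (U x) (U y) = (\<Sum>d\<in>C. \<Sum>c\<in>C. c * cnj d * ip (e c x) (e d y))"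
      by (simp add: U_def ip_sum_left ip_sum_right ip_scale_left ip_scale_right
          sum_distrib_left sum_distrib_right mult.assoc mult.left_commute)
    also have "\<dots> = (\<Sum>d\<in>C. \<Sum>c\<in>C. ip (e c x) (e d y))"
      by (intro sum.cong refl terms)
    also have "\<dots> = ip (\<Sum>c\<in>C. e c x) (\<Sum>d\<in>C. e d y)"
      by (simp add: ip_sum_left ip_sum_right)
    finally show ?thesis by (simp add: e_sum)
  qed
  \<comment> \<open>On the invariant range of \<open>e c\<close> the operator \<open>U\<close> is
    the scalar \<open>c\<close>, so \<open>Q\<close> is \<open>T - c\<close> there, which is
    nilpotent.\<close>
  have Q_e: "(Q ^^ k) (e c x) = ((\<lambda>x. T x - sc c x) ^^ k) (e c x)" if "c \<in> C" for k c x
  proof (induction k arbitrary: x)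
    case (Suc k)
    have "Q (e c x) = e c (T x - sc c x)"
      by (simp add: Q_def U_e that lin_simps[OF lin_e] e_T)
    moreover have "T (e c x) - sc c (e c x) = e c (T x - sc c x)"
      by (simp add: lin_simps[OF lin_e] e_T)
    ultimately show ?case
      by (simp only: funpow_Suc_right o_apply Suc.IH)
  qed simp
  have "(Q ^^ N) x = 0" for x
  proof -
    have "(Q ^^ N) (\<Sum>c\<in>C. e c x) = 0"
      unfolding lin_simps[OF lin_pow[OF lin_Q]] by (intro sum.neutral) (simp add: Q_e e_N)
    then show ?thesis by (simp add: e_sum)
  qed
  then have Q0: "Q ^^ N = (\<lambda>x. 0)" by (intro ext)
  let ?V = "\<Union>c\<in>C. range (e c)"
  have spanV: "span ?V = UNIV"
  proof -
    have "(\<Sum>c\<in>C. e c x) \<in> span ?V" for x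
      by (intro span_sum span_base) auto
    then show ?thesis by (auto simp: e_sum)
  qed
  \<comment> \<open>The spanning set \<open>?V\<close> consists of vectors that \<open>U\<close>
    scales, so a basis selected from it diagonalizes \<open>U\<close>.\<close>
  obtain B where B: "B \<subseteq> ?V" "independent B" "?V \<subseteq> span B"
    using maximal_independent_subset[of ?V] by blast
  have "diagonalizable_op sc U"
    unfolding diagonalizable_op_def
  proof (intro exI[of _ B] conjI ballI)
    show "span B = UNIV"
      using span_minimal[OF B(3)] spanV by auto
    show "\<exists>c. U b = sc c b" if "b \<in> B" for b
      using B(1) that U_e by blast
  qed (use B in auto)
  moreover have "T = (\<lambda>x. U x + Q x)" by (simp add: Q_def fun_eq_iff)
  moreover have "U \<circ> Q = Q \<circ> U"
    by (rule ext) (simp add: Q_def lin_simps[OF lin_U] TU)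
  ultimately show thesis using that lin_U lin_Q Q0 unitary by blast
qed

section \<open>Unitary plus commuting nilpotent: the exact order\<close>

text \<open>
  For commuting \<open>U\<close> and \<open>Q\<close> with \<open>U\<close> unitary, one difference step turns the form
  \<open>ip (Q^i U^a x) (Q^j U^b y)\<close> into a sum of such forms with more factors \<open>Q\<close>.
\<close>

context
  fixes T U Q d
  assumes lin_U: "lin U" and lin_Q: "lin Q" and TUQ: "T = (\<lambda>x. U x + Q x)"
    and comm: "U \<circ> Q = Q \<circ> U" and unitary: "\<And>x y. ip (U x) (U y) = ip x y"
    and nilp: "nilpotent_of_order d Q"
begin

definition mixed_form :: "nat \<Rightarrow> nat \<Rightarrow> nat \<Rightarrow> nat \<Rightarrow> 'a \<Rightarrow> 'a \<Rightarrow> complex" where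
  "mixed_form i j a b = (\<lambda>x y. ip ((Q ^^ i) ((U ^^ a) x)) ((Q ^^ j) ((U ^^ b) y)))"

lemma UQ: "U (Q x) = Q (U x)"
  using comm by (metis comp_apply)

lemma UQ_pow: "U ((Q ^^ i) x) = (Q ^^ i) (U x)"
  by (induction i) (simp_all add: UQ)

lemma Q_pow_vanishes:
  assumes "d \<le> i"
  shows "(Q ^^ i) x = 0"
proof -
  have "(Q ^^ i) x = (Q ^^ (i - d)) ((Q ^^ d) x)"
    using assms by (metis funpow_add le_add_diff_inverse2 o_apply)
  then show ?thesis using nilp by (simp add: nilpotent_of_order_def lin_simps[OF lin_pow[OF lin_Q]])
qed

lemma mixed_form_vanishes: "d \<le> i \<or> d \<le> j \<Longrightarrow> mixed_form i j a b = (\<lambda>x y. 0)"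
  by (auto simp: mixed_form_def Q_pow_vanishes)

lemma form_diff_mixed_form:
  "form_diff T (mixed_form i j a b) = (\<lambda>x y. (mixed_form (Suc i) j a (Suc b) x y
     + mixed_form i (Suc j) (Suc a) b x y) + mixed_form (Suc i) (Suc j) a b x y)"
proof (intro ext)
  fix x y
  have QU: "(U ^^ a) (Q x) = Q ((U ^^ a) x)" for a x
    by (induction a) (simp_all add: UQ)
  have *: "(Q ^^ i) ((U ^^ a) (T x)) = (Q ^^ i) ((U ^^ Suc a) x) + (Q ^^ Suc i) ((U ^^ a) x)" for i a x
    by (simp add: TUQ lin_simps[OF lin_pow[OF lin_Q]] lin_simps[OF lin_pow[OF lin_U]] QU funpow_swap1)
  \<comment> \<open>Unitarity removes one \<open>U\<close> from both sides, so the term without a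
    new \<open>Q\<close> cancels the subtracted form.\<close>
  have **: "mixed_form i j (Suc a) (Suc b) x y = mixed_form i j a b x y"
    by (simp add: mixed_form_def unitary flip: UQ_pow)
  have "form_diff T (mixed_form i j a b) x y = (mixed_form i j (Suc a) (Suc b) x y +
      (mixed_form (Suc i) j a (Suc b) x y + mixed_form i (Suc j) (Suc a) b x y)
      + mixed_form (Suc i) (Suc j) a b x y) - mixed_form i j a b x y"
    by (simp only: form_diff_def mixed_form_def * ip_simps) (simp add: algebra_simps)
  then show "form_diff T (mixed_form i j a b) x y = (mixed_form (Suc i) j a (Suc b) x y
     + mixed_form i (Suc j) (Suc a) b x y) + mixed_form (Suc i) (Suc j) a b x y"
    unfolding ** by simp
qed

lemma form_diff_pow_mixed_form_Suc:
  "(form_diff T ^^ Suc k) (mixed_form i j a b) = (\<lambda>x y.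
     ((form_diff T ^^ k) (mixed_form (Suc i) j a (Suc b)) x y
     + (form_diff T ^^ k) (mixed_form i (Suc j) (Suc a) b) x y)
     + (form_diff T ^^ k) (mixed_form (Suc i) (Suc j) a b) x y)"
  unfolding form_diff_pow_Suc' form_diff_mixed_form form_diff_pow_add ..

text \<open>Each step raises \<open>i + j\<close> by at least one, and once \<open>i + j\<close>
  reaches \<open>2 * d - 1\<close>, one of the two exponents is at least \<open>d\<close>.\<close>

lemma form_diff_pow_mixed_form_vanishes:
  "2 * d - 1 \<le> i + j + k \<Longrightarrow> (form_diff T ^^ k) (mixed_form i j a b) = (\<lambda>x y. 0)"
proof (induction k arbitrary: i j a b)
  case 0
  then have "d \<le> i \<or> d \<le> j" by linarith
  then show ?case by (simp add: mixed_form_vanishes)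
next
  case (Suc k)
  then show ?case by (simp only: form_diff_pow_mixed_form_Suc) simp
qed

text \<open>\<open>p\<close> and \<open>q\<close> count the factors \<open>Q\<close> still missing
  on the left and on the right. With only \<open>p + q\<close> steps left, each must add exactly one
  factor; the coefficient counts the orders in which this can happen. A new \<open>Q\<close> on one
  side comes with a \<open>U\<close> on the other, hence \<open>a + q\<close> and
  \<open>b + p\<close>.\<close>

lemma form_diff_pow_mixed_form_top:
  assumes "i + p = d - 1" "j + q = d - 1"
  shows "(form_diff T ^^ (p + q)) (mixed_form i j a b)
    = (\<lambda>x y. of_nat ((p + q) choose p) * mixed_form (d - 1) (d - 1) (a + q) (b + p) x y)"
  using assms
proof (induction "p + q" arbitrary: p q i j a b)
  case 0
  then show ?case by simp
next
  case (Suc k)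
  have d: "1 \<le> d" using nilp by (simp add: nilpotent_of_order_def)
  \<comment> \<open>Adding a factor on both sides in one step overshoots: the exponents and the
    remaining steps now sum to \<open>2 * d - 1\<close>.\<close>
  have van: "(form_diff T ^^ k) (mixed_form (Suc i) (Suc j) a b) = (\<lambda>x y. 0)"
    using Suc d by (intro form_diff_pow_mixed_form_vanishes) linarith
  \<comment> \<open>If \<open>p = 0\<close> or \<open>q = 0\<close>, the exponent on that side is
    already \<open>d - 1\<close>, and another \<open>Q\<close> there gives zero.\<close>
  consider "p = 0" | "q = 0" | p' q' where "p = Suc p'" "q = Suc q'"
    by (cases p; cases q) auto
  then show ?case
  proof cases
    case 1
    then have "q = Suc k" "Suc i = d" using Suc d by auto
    then show ?thesis
      using Suc.hyps(1)[of 0 k i "Suc j" "Suc a" b] Suc.prems 1 van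
      unfolding Suc.hyps(2)[symmetric] form_diff_pow_mixed_form_Suc by (simp add: mixed_form_vanishes)
  next
    case 2
    then have "p = Suc k" "Suc j = d" using Suc d by auto
    then show ?thesis
      using Suc.hyps(1)[of k 0 "Suc i" j a "Suc b"] Suc.prems 2 van
      unfolding Suc.hyps(2)[symmetric] form_diff_pow_mixed_form_Suc by (simp add: mixed_form_vanishes)
  next
    case 3
    have k: "k = p' + q" "k = p + q'" using Suc 3 by auto
    have 1: "(form_diff T ^^ k) (mixed_form (Suc i) j a (Suc b))
      = (\<lambda>x y. of_nat (k choose p') * mixed_form (d - 1) (d - 1) (a + q) (b + p) x y)"
      using Suc.hyps(1)[of p' q "Suc i" j a "Suc b"] Suc.prems 3 k by simp
    have 2: "(form_diff T ^^ k) (mixed_form i (Suc j) (Suc a) b)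
      = (\<lambda>x y. of_nat (k choose p) * mixed_form (d - 1) (d - 1) (a + q) (b + p) x y)"
      using Suc.hyps(1)[of p q' i "Suc j" "Suc a" b] Suc.prems 3 k by simp
    have "Suc k choose p = (k choose p') + (k choose p)" using 3 by simp
    then show ?thesis
      unfolding Suc.hyps(2)[symmetric] form_diff_pow_mixed_form_Suc 1 2 van
      by (simp add: algebra_simps del: binomial_Suc_Suc)
  qed
qed

lemma unitary_plus_nilpotent_strict:
  shows "(form_diff T ^^ (2 * d - 1)) ip = (\<lambda>x y. 0)"
    and "(form_diff T ^^ (2 * d - 2)) ip \<noteq> (\<lambda>x y. 0)"
proof -
  have ip: "ip = mixed_form 0 0 0 0" by (simp add: mixed_form_def fun_eq_iff)
  then show "(form_diff T ^^ (2 * d - 1)) ip = (\<lambda>x y. 0)"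
    using form_diff_pow_mixed_form_vanishes[of 0 0 "2 * d - 1" 0 0] by simp
  obtain v where v: "(Q ^^ (d - 1)) v \<noteq> 0" using nilp by (auto simp: nilpotent_of_order_def fun_eq_iff)
  have iter: "ip ((U ^^ k) x) ((U ^^ k) x) = ip x x" for k x
    by (induction k) (simp_all add: unitary)
  have swap: "(Q ^^ i) ((U ^^ a) x) = (U ^^ a) ((Q ^^ i) x)" for i a x
    by (induction a) (simp_all add: UQ_pow[symmetric])
  have "(form_diff T ^^ (2 * d - 2)) ip v v
      = of_nat ((2 * d - 2) choose (d - 1)) * ip ((Q ^^ (d - 1)) v) ((Q ^^ (d - 1)) v)"
    using form_diff_pow_mixed_form_top[of 0 "d - 1" 0 "d - 1" 0 0]
    by (simp add: ip[symmetric] mixed_form_def swap iter mult_2[symmetric] right_diff_distrib')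
  moreover have "((2 * d - 2) choose (d - 1)) \<noteq> 0" by simp
  ultimately have "(form_diff T ^^ (2 * d - 2)) ip v v \<noteq> 0" using v by (simp del: binomial_eq_0_iff)
  then show "(form_diff T ^^ (2 * d - 2)) ip \<noteq> (\<lambda>x y. 0)" by auto
qed

end

section \<open>Counting eigenvalues\<close>

lemma unitary_eigenvalue_unimodular:
  assumes "\<And>x y. ip (U x) (U y) = ip x y" "c \<in> op_eigenvalues sc U"
  shows "cmod c = 1"
proof -
  obtain v where v: "v \<noteq> 0" "U v = sc c v" using assms(2) by (auto simp: op_eigenvalues_def)
  have "(c * cnj c) * ip v v = ip v v"
    using assms(1)[of v v] by (simp add: v ip_scale_left ip_scale_right mult_ac)
  then have "c * cnj c = 1" using v by simp
  then have "complex_of_real ((cmod c)\<^sup>2) = 1" by (simp only: complex_norm_square)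
  then have "(cmod c)\<^sup>2 = 1" by (metis of_real_eq_1_iff)
  then show ?thesis using norm_ge_zero[of c] power2_eq_1_iff[of "cmod c"] by linarith
qed

lemma unitary_eigenvectors_orthogonal:
  assumes "\<And>x y. ip (U x) (U y) = ip x y" "U v = sc c v" "U w = sc d w" "c \<noteq> d"
  shows "ip v w = 0"
proof (rule ccontr)
  assume nz: "ip v w \<noteq> 0"
  then have "w \<noteq> 0" by auto
  then have "cmod d = 1"
    using assms by (intro unitary_eigenvalue_unimodular[of U]) (auto simp: op_eigenvalues_def)
  then have "cnj d * d = 1" using complex_norm_square[of d] by (simp add: mult.commute)
  have "(c * cnj d) * ip v w = ip v w"
    using assms(1)[of v w] by (simp add: assms(2,3) ip_scale_left ip_scale_right mult_ac)
  then have "c * cnj d = 1" using nz by simp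
  then have "c * (cnj d * d) = d" by (metis mult.assoc mult_1)
  then show False using \<open>cnj d * d = 1\<close> assms(4) by simp
qed

text \<open>Chains are built from their last vector backwards: \<open>Q ^^ (d - 1 - k)\<close> kills
  the later vectors but sends the new one to \<open>(Q ^^ (d - 1)) v\<close>, which is
  nonzero.\<close>

lemma nilpotent_chain_independent:
  assumes Q: "lin Q" and v: "(Q ^^ (d - 1)) v \<noteq> 0" and d: "(Q ^^ d) v = 0" and k: "k \<le> d"
  shows "independent ((\<lambda>i. (Q ^^ i) v) ` {k..<d}) \<and> card ((\<lambda>i. (Q ^^ i) v) ` {k..<d}) = d - k"
  using k
proof (induction k rule: inc_induct)
  case base
  show ?case by (simp add: independent_empty)
next
  case (step k)
  let ?S = "(\<lambda>i. (Q ^^ i) v) ` {Suc k..<d}"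
  have "{k..<d} = insert k {Suc k..<d}" using step.hyps by auto
  then have split: "(\<lambda>i. (Q ^^ i) v) ` {k..<d} = insert ((Q ^^ k) v) ?S"
    by simp
  have kill: "(Q ^^ (d - 1 - k)) s = 0" if "s \<in> span ?S" for s
  proof -
    have "(Q ^^ (d - 1 - k)) s = (\<lambda>x. 0) s"
    proof (rule lin_eq_on_span[OF lin_pow[OF Q] _ that])
      show "lin (\<lambda>x. 0)" by (rule linI) auto
      fix b assume "b \<in> ?S"
      then obtain i where i: "b = (Q ^^ i) v" "Suc k \<le> i" "i < d" by auto
      have "(Q ^^ (d - 1 - k)) b = (Q ^^ (i - Suc k)) ((Q ^^ d) v)"
        unfolding i(1) using i(2,3) by (simp add: add.commute flip: funpow_add[THEN fun_cong, unfolded o_apply])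
      then show "(Q ^^ (d - 1 - k)) b = 0" by (simp add: d lin_simps[OF lin_pow[OF Q]])
    qed
    then show ?thesis .
  qed
  have "(Q ^^ (d - 1 - k)) ((Q ^^ k) v) = (Q ^^ (d - 1)) v"
    using step.hyps by (simp flip: funpow_add[THEN fun_cong, unfolded o_apply])
  then have notin: "(Q ^^ k) v \<notin> span ?S" using kill v by auto
  then have "(Q ^^ k) v \<notin> ?S" using span_base[of "(Q ^^ k) v" ?S] by argo
  then show ?case
    unfolding split using step notin by (auto simp: independent_insertI)
qed

lemma card_eigenvalues_add_nilpotency_order_le:
  assumes lin_Q: "lin Q" and lin_U: "lin U" and comm: "U \<circ> Q = Q \<circ> U"
    and unitary: "\<And>x y. ip (U x) (U y) = ip x y" and nilp: "nilpotent_of_order d Q"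
    and diag: "diagonalizable_op sc U"
  shows "card (op_eigenvalues sc U) + d \<le> dim UNIV + 1"
proof -
  have d: "1 \<le> d" "(Q ^^ d) x = 0" for x using nilp by (auto simp: nilpotent_of_order_def)
  obtain B where B: "span B = UNIV" "\<And>b. b \<in> B \<Longrightarrow> \<exists>c. U b = sc c b"
    using diag by (auto simp: diagonalizable_op_def)
  \<comment> \<open>If \<open>Q ^^ (d - 1)\<close> killed a whole eigenbasis of \<open>U\<close>, it
    would be zero. So a chain of full length can start at an eigenvector of
    \<open>U\<close>.\<close>
  have "\<exists>b\<in>B. (Q ^^ (d - 1)) b \<noteq> 0"
  proof (rule ccontr)
    assume neg: "\<not> ?thesis"
    have "lin (\<lambda>x. 0)" by (rule linI) auto
    then have "(Q ^^ (d - 1)) x = 0" for x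
      using neg B(1) lin_eq_on_span[OF lin_pow[OF lin_Q], of "\<lambda>x. 0" x B "d - 1"] by simp
    then have "Q ^^ (d - 1) = (\<lambda>x. 0)" by (rule ext)
    then show False using nilp by (simp add: nilpotent_of_order_def)
  qed
  then obtain b c0 where b: "(Q ^^ (d - 1)) b \<noteq> 0" "U b = sc c0 b" using B(2) by blast
  have "b \<noteq> 0" using b(1) by (auto simp: lin_simps[OF lin_pow[OF lin_Q]])
  then have c0: "c0 \<in> op_eigenvalues sc U" using b by (auto simp: op_eigenvalues_def)
  define A where "A = (\<lambda>i. (Q ^^ i) b) ` {0..<d}"
  have A: "independent A" "card A = d" "finite A"
    using nilpotent_chain_independent[OF lin_Q b(1) d(2), of 0] by (auto simp: A_def)
  \<comment> \<open>\<open>Q\<close> commutes with \<open>U\<close>, so the chain stays in the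
    eigenspace for \<open>c0\<close>.\<close>
  have UA: "U a = sc c0 a" if "a \<in> A" for a
  proof -
    have "U ((Q ^^ i) b) = sc c0 ((Q ^^ i) b)" for i
    proof (induction i)
      case (Suc i)
      then show ?case using comm[THEN fun_cong, of "(Q ^^ i) b"] by (simp add: lin_simps[OF lin_Q])
    qed (simp add: b)
    then show ?thesis using that by (auto simp: A_def)
  qed
  define w where "w c = (SOME v. v \<noteq> 0 \<and> U v = sc c v)" for c
  have w: "w c \<noteq> 0" "U (w c) = sc c (w c)" if "c \<in> op_eigenvalues sc U" for c
    unfolding w_def using that someI_ex[of "\<lambda>v. v \<noteq> 0 \<and> U v = sc c v"]
    by (auto simp: op_eigenvalues_def)
  \<comment> \<open>Eigenvectors of a unitary operator for distinct eigenvalues are orthogonal, so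
    each new \<open>w c\<close> is orthogonal to the span reached so far and lies outside
    it.\<close>
  have main: "independent (A \<union> w ` F) \<and> card (A \<union> w ` F) = d + card F"
    if "finite F" "F \<subseteq> op_eigenvalues sc U - {c0}" for F
    using that
  proof (induction F rule: finite_induct)
    case (insert c F)
    have "ip (w c) s = 0" if "s \<in> span (A \<union> w ` F)" for s
      using that
    proof (induction rule: span_induct_alt)
      case (step r x y)
      have "ip (w c) x = 0"
        using step(1) UA insert.hyps insert.prems
        by (auto intro!: unitary_eigenvectors_orthogonal[OF unitary w(2)] w(2))
      then show ?case using step by (simp add: ip_simps)
    qed simp
    moreover have "ip (w c) (w c) \<noteq> 0" using insert.prems w by auto
    ultimately have notin: "w c \<notin> span (A \<union> w ` F)" by blast
    then have "w c \<notin> A \<union> w ` F" using span_base[of "w c" "A \<union> w ` F"] by argo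
    then show ?case
      using insert notin A(3) by (auto simp: independent_insertI)
  qed (use A in auto)
  show ?thesis
  proof (cases "finite (op_eigenvalues sc U)")
    case True
    let ?F = "op_eigenvalues sc U - {c0}"
    have "d + card ?F \<le> dim UNIV"
      using main[of ?F] True card_independent_le_dim by fastforce
    moreover have "card (op_eigenvalues sc U) = Suc (card ?F)"
      by (rule card.remove[OF True c0])
    ultimately show ?thesis by simp
  next
    \<comment> \<open>An infinite set has \<open>card\<close> equal to \<open>0\<close>, so the
      bound \<open>d\<close> on the chain alone suffices.\<close>
    case False
    then show ?thesis
      using main[of "{}"] card_independent_le_dim[of A] A by auto
  qed
qed

section \<open>Making the diagonalizable part unitary\<close>

lemma unimodular_diagonalizable_unitarizable:
  assumes lin_U: "lin U" and diag: "diagonalizable_op sc U"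
    and unimod: "\<And>c. c \<in> op_eigenvalues sc U \<Longrightarrow> cmod c = 1"
  obtains P R where "lin P" "lin R" "R \<circ> P = id" "P \<circ> R = id"
    "\<And>x y. ip (P (U x)) (P (U y)) = ip (P x) (P y)"
proof -
  interpret vsp: vector_space_pair sc sc ..
  obtain B where B: "independent B" "span B = UNIV" "\<And>b. b \<in> B \<Longrightarrow> \<exists>c. U b = sc c b"
    using diag by (auto simp: diagonalizable_op_def)
  obtain E where E: "finite E" "orthonormal E" "independent E" "span E = UNIV"
    using ex_orthonormal_basis by blast
  have fB: "finite B" using card_independent_le_dim[OF B(1)] by simp
  have card: "card B = dim UNIV" "card E = dim UNIV"
    using B E by (auto intro!: basis_card_eq_dim)
  \<comment> \<open>\<open>P\<close> carries an eigenbasis of \<open>U\<close> to an orthonormal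
    basis, so the pulled-back inner product makes the eigenbasis orthonormal.\<close>
  obtain P where P: "lin P" "P ` B = E" "inj P" "surj P"
    using vsp.finite_basis_to_basis_subspace_isomorphism[of UNIV UNIV B E] B E fB card
    by (auto simp: subspace_UNIV)
  obtain R where R: "lin R" "R \<circ> P = id"
    using vsp.linear_injective_left_inverse[OF P(1,3)] by blast
  have PR: "P \<circ> R = id"
  proof
    fix y
    obtain x where "y = P x" using P(4) by blast
    then show "(P \<circ> R) y = id y" using R(2)[THEN fun_cong, of x] by simp
  qed
  have basis: "ip (P (U a)) (P (U b)) = ip (P a) (P b)" if ab: "a \<in> B" "b \<in> B" for a b
  proof -
    obtain c d where cd: "U a = sc c a" "U b = sc d b" using B(3) ab by meson
    have "b \<noteq> 0" using ab B(1) dependent_zero by blast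
    then have "cmod d = 1" using cd by (intro unimod) (auto simp: op_eigenvalues_def)
    then have "d * cnj d = 1" using complex_norm_square[of d] by simp
    have "P a \<in> E" "P b \<in> E" using P(2) ab by auto
    then have "a = b \<or> ip (P a) (P b) = 0"
      using E(2) P(3) by (auto simp: orthonormal_def inj_def)
    moreover have "c = d" if "a = b" using that cd \<open>b \<noteq> 0\<close> by simp
    ultimately show ?thesis
      using \<open>d * cnj d = 1\<close>
      by (auto simp: cd lin_simps[OF P(1)] ip_scale_left ip_scale_right mult.assoc[symmetric]
          mult.commute)
  qed
  \<comment> \<open>Sesquilinear extension from basis pairs, one argument at a time.\<close>
  have right: "ip (P (U a)) (P (U y)) = ip (P a) (P y)" if "a \<in> B" for a y
  proof -
    have "y \<in> span B" using B(2) by simp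
    then show ?thesis
      by (induction rule: span_induct_alt)
        (simp_all add: lin_simps[OF P(1)] lin_simps[OF lin_U] ip_simps basis that)
  qed
  have "ip (P (U x)) (P (U y)) = ip (P x) (P y)" for x y
  proof -
    have "x \<in> span B" using B(2) by simp
    then show ?thesis
      by (induction rule: span_induct_alt)
        (simp_all add: lin_simps[OF P(1)] lin_simps[OF lin_U] ip_simps right)
  qed
  then show thesis using that P R PR by blast
qed

section \<open>The two directions and the equivalence\<close>

text \<open>The parity of \<open>m\<close> is a conclusion here: the iterated differences of
  \<open>ip\<close> first vanish at index \<open>m\<close> and also at index
  \<open>2 * d - 1\<close>.\<close>

lemma strict_m_isometry_decomposition:
  assumes T: "lin T" and m: "2 \<le> m" and st: "strict_m_isometry sc ip m T"
  shows "\<exists>U Q d. lin U \<and> lin Q \<and> T = (\<lambda>x. U x + Q x) \<and> diagonalizable_op sc U \<and>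
    (\<forall>c\<in>op_eigenvalues sc U. cmod c = 1) \<and> card (op_eigenvalues sc U) + d \<le> dim UNIV + 1 \<and>
    nilpotent_of_order d Q \<and> U \<circ> Q = Q \<circ> U \<and> m = 2 * d - 1"
proof -
  have D: "(form_diff T ^^ m) ip = (\<lambda>x y. 0)" "(form_diff T ^^ (m - 1)) ip \<noteq> (\<lambda>x y. 0)"
    using st m by (simp_all add: strict_m_isometry_iff)
  have nz: "\<exists>x :: 'a. x \<noteq> 0"
  proof (rule ccontr)
    assume "\<not> ?thesis"
    then have "ip = (\<lambda>x y. 0)" by (metis ip_zero_left)
    then show False using D(2) by simp
  qed
  obtain U Q N where UQ: "lin U" "lin Q" "T = (\<lambda>x. U x + Q x)" "U \<circ> Q = Q \<circ> U"
    "Q ^^ N = (\<lambda>x. 0)" and unitary: "\<And>x y. ip (U x) (U y) = ip x y" and diag: "diagonalizable_op sc U"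
    using unitary_plus_nilpotent_decomposition[OF T nz D(1)] by blast
  \<comment> \<open>The least exponent is the order of nilpotency; it is positive because
    \<open>Q ^^ 0\<close> is the identity on a nonzero space.\<close>
  define d where "d = (LEAST N. Q ^^ N = (\<lambda>x. 0))"
  have "Q ^^ d = (\<lambda>x. 0)" unfolding d_def by (rule LeastI) (rule UQ(5))
  moreover have "d \<noteq> 0"
    using \<open>Q ^^ d = (\<lambda>x. 0)\<close> nz by (cases "d = 0") (auto simp: fun_eq_iff)
  moreover have "Q ^^ (d - 1) \<noteq> (\<lambda>x. 0)"
    using not_less_Least[of "d - 1" "\<lambda>N. Q ^^ N = (\<lambda>x. 0)"] \<open>d \<noteq> 0\<close> unfolding d_def by simp
  ultimately have nilp: "nilpotent_of_order d Q" by (simp add: nilpotent_of_order_def)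
  note s = unitary_plus_nilpotent_strict[OF UQ(1-4) unitary nilp]
  have "\<not> m \<le> 2 * d - 2" using s(2) form_diff_pow_mono[OF D(1)] by blast
  moreover have "\<not> 2 * d - 1 \<le> m - 1" using D(2) form_diff_pow_mono[OF s(1)] by blast
  ultimately have "m = 2 * d - 1" using m by linarith
  moreover have "card (op_eigenvalues sc U) + d \<le> dim UNIV + 1"
    by (rule card_eigenvalues_add_nilpotency_order_le[OF UQ(2,1,4) unitary nilp diag])
  ultimately show ?thesis
    using UQ diag nilp unitary_eigenvalue_unimodular[OF unitary] by blast
qed

lemma unimodular_plus_nilpotent_similar_strict_m_isometry:
  assumes lin_U: "lin U" and lin_Q: "lin Q" and TUQ: "T = (\<lambda>x. U x + Q x)"
    and diag: "diagonalizable_op sc U"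
    and unimod: "\<And>c. c \<in> op_eigenvalues sc U \<Longrightarrow> cmod c = 1"
    and nilp: "nilpotent_of_order d Q" and d: "2 \<le> d" and comm: "U \<circ> Q = Q \<circ> U"
  shows "\<exists>S. strict_m_isometry sc ip (2 * d - 1) S \<and> similar_ops sc T S"
proof -
  obtain P R where P: "lin P" "lin R" "R \<circ> P = id" "P \<circ> R = id"
    and unitary: "\<And>x y. ip (P (U x)) (P (U y)) = ip (P x) (P y)"
    using unimodular_diagonalizable_unitarizable[OF lin_U diag unimod] by blast
  have RP: "R (P x) = x" "P (R x) = x" for x
    using P(3,4) by (metis comp_apply id_apply)+
  \<comment> \<open>Transporting \<open>T\<close> by \<open>P\<close> makes the behaviour of
    \<open>S\<close> under \<open>ip\<close> that of \<open>T\<close> under the pulled-back product,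
    for which \<open>U\<close> is unitary.\<close>
  define S where "S = P \<circ> T \<circ> R"
  have lin_T: "lin T"
    by (rule linI) (simp_all add: TUQ lin_simps[OF lin_U] lin_simps[OF lin_Q] scale_right_distrib)
  have lin_S: "lin S"
    by (rule linI) (simp_all add: S_def lin_simps[OF P(1)] lin_simps[OF P(2)] lin_simps[OF lin_T])
  let ?ip = "\<lambda>x y. ip (P x) (P y)"
  have "inj P" by (metis RP(1) injI)
  interpret PB: fd_complex_hilbert_space sc ?ip
    by (rule pullback_space[OF P(1) \<open>inj P\<close>])
  note s = PB.unitary_plus_nilpotent_strict[OF lin_U lin_Q TUQ comm unitary nilp]
  have tr: "(form_diff S ^^ k) ip x y = (form_diff T ^^ k) ?ip (R x) (R y)" for k x y
    using form_diff_pow_conj[of P T S k ip "R x" "R y"] by (simp add: S_def RP)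
  have "(form_diff S ^^ (2 * d - 1)) ip = (\<lambda>x y. 0)"
    by (intro ext) (simp only: tr s(1))
  moreover have "(form_diff S ^^ (2 * d - 2)) ip \<noteq> (\<lambda>x y. 0)"
  proof
    assume "(form_diff S ^^ (2 * d - 2)) ip = (\<lambda>x y. 0)"
    then have "(form_diff T ^^ (2 * d - 2)) ?ip x y = 0" for x y
      using tr[of "2 * d - 2" "P x" "P y"] by (simp add: RP)
    then show False using s(2) by (simp add: fun_eq_iff)
  qed
  moreover have "2 * d - 1 - 1 = 2 * d - 2" by simp
  ultimately have "strict_m_isometry sc ip (2 * d - 1) S"
    using d lin_S by (simp add: strict_m_isometry_iff del: diff_diff_left)
  moreover have "similar_ops sc T S"
    unfolding similar_ops_def hilbert_ops_def using P
    by (intro bexI[of _ P] bexI[of _ R]) (auto simp: S_def fun_eq_iff RP)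
  ultimately show ?thesis by blast
qed

end

theorem theorem5p4:
  fixes sc :: "complex \<Rightarrow> 'a::ab_group_add \<Rightarrow> 'a"
    and ip :: "'a \<Rightarrow> 'a \<Rightarrow> complex"
    and n m :: nat
    and T :: "'a \<Rightarrow> 'a"
  assumes "fd_complex_hilbert_space sc ip"
    and "vector_space.dim sc (UNIV :: 'a set) = n"
    and "odd m" and "3 \<le> m" and "m \<le> 2 * n - 1"
    and "T \<in> hilbert_ops sc"
  shows "(\<exists>S. strict_m_isometry sc ip m S \<and> similar_ops sc T S) \<longleftrightarrow>
    (\<exists>U\<in>hilbert_ops sc. \<exists>Q\<in>hilbert_ops sc.
       T = (\<lambda>x. U x + Q x) \<and>
       diagonalizable_op sc U \<and>
       (\<forall>c\<in>op_eigenvalues sc U. cmod c = 1) \<and>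
       card (op_eigenvalues sc U) \<le> (2 * n + 1 - m) div 2 \<and>
       nilpotent_of_order ((m + 1) div 2) Q \<and>
       U \<circ> Q = Q \<circ> U)"
    (is "?lhs \<longleftrightarrow> ?rhs")
proof -
  interpret fd_complex_hilbert_space sc ip by fact
  obtain d where md: "m = 2 * d - 1" "(m + 1) div 2 = d" "2 \<le> d"
    using assms(3,4) by (elim oddE) (rule that, auto)
  have lin_T: "lin T" using assms(6) by (simp add: hilbert_ops_def)
  show ?thesis
  proof
    assume ?lhs
    then obtain S P R where S: "strict_m_isometry sc ip m S"
      and P: "lin P" "R \<circ> P = id" "P \<circ> R = id" "T = R \<circ> S \<circ> P"
      by (auto simp: similar_ops_def hilbert_ops_def)
    have RP: "R (P x) = x" "P (R x) = x" for x
      using P(2,3) by (metis comp_apply id_apply)+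
    let ?ip = "\<lambda>x y. ip (P x) (P y)"
    have "inj P" by (metis RP(1) injI)
    interpret PB: fd_complex_hilbert_space sc ?ip
      by (rule pullback_space[OF P(1) \<open>inj P\<close>])
    \<comment> \<open>The strict \<open>m\<close>-isometry property of \<open>S\<close> for
      \<open>ip\<close> passes to \<open>T\<close> for \<open>?ip\<close>. Since \<open>T\<close>
      itself is then decomposed, \<open>U\<close> and \<open>Q\<close> need not be conjugated
      back.\<close>
    have tr: "(form_diff T ^^ k) ?ip x y = (form_diff S ^^ k) ip (P x) (P y)" for k x y
      using form_diff_pow_conj[of P T S k ip x y] by (simp add: P(4) RP)
    have m: "2 \<le> m" using assms(4) by simp
    have D: "(form_diff S ^^ m) ip = (\<lambda>x y. 0)" "(form_diff S ^^ (m - 1)) ip \<noteq> (\<lambda>x y. 0)"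
      using S by (simp_all add: strict_m_isometry_iff[OF m])
    have "(form_diff T ^^ m) ?ip = (\<lambda>x y. 0)"
      by (intro ext) (simp add: tr D(1))
    moreover have "(form_diff T ^^ (m - 1)) ?ip \<noteq> (\<lambda>x y. 0)"
    proof
      assume "(form_diff T ^^ (m - 1)) ?ip = (\<lambda>x y. 0)"
      then have "(form_diff S ^^ (m - 1)) ip x y = 0" for x y
        using tr[of "m - 1" "R x" "R y"] by (simp add: RP)
      then show False using D(2) by (simp add: fun_eq_iff)
    qed
    ultimately have "strict_m_isometry sc ?ip m T"
      using lin_T by (simp add: PB.strict_m_isometry_iff[OF m])
    from PB.strict_m_isometry_decomposition[OF lin_T m this]
    obtain U Q e where "lin U" "lin Q" "T = (\<lambda>x. U x + Q x)" "diagonalizable_op sc U"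
      "\<forall>c\<in>op_eigenvalues sc U. cmod c = 1" "card (op_eigenvalues sc U) + e \<le> n + 1"
      "nilpotent_of_order e Q" "U \<circ> Q = Q \<circ> U" "m = 2 * e - 1"
      using assms(2) by blast
    moreover have "e = d" using \<open>m = 2 * e - 1\<close> md by linarith
    \<comment> \<open>With \<open>m = 2 * d - 1\<close> the numerator is
      \<open>2 * (n + 1 - d)\<close>, so the division is exact.\<close>
    moreover have "(2 * n + 1 - m) div 2 = n + 1 - d" using md by simp
    ultimately show ?rhs
      unfolding md(2) hilbert_ops_def by (intro bexI[of _ U] bexI[of _ Q]) auto
  next
    assume ?rhs
    then show ?lhs
      unfolding md(2) hilbert_ops_def
      using unimodular_plus_nilpotent_similar_strict_m_isometry[OF _ _ _ _ _ _ md(3), folded md(1)]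
      by blast
  qed
qed

end
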